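(* Let $X$ and $Y$ be Banach spaces and let $T\in LR(X,Y)$ have closed range $R(T)$. Then $T$ is closed if and only if $T^{-1}$ is bounded and $N(T)$ is closed.
   Context: All spaces are over the same scalar field ($\mathbf R$ or $\mathbf C$). $LR(X,Y)$ is the set of all linear subspaces of $X\times Y$. For $T\in LR(X,Y)$: $D(T)$ and $R(T)$ are its domain and range, $T(x)=\{y\in Y:(x,y)\in T\}$, $N(T)=\{x\in X:(x,0)\in T\}$, and $T^{-1}=\{(y,x):(x,y)\in T\}\in LR(Y,X)$. $T$ is closed if it is closed in $X\times Y$. Boundedness of a subspace $W\in LR(U,V)$ of a product of normed spaces: for $u\in D(W)$, $\|W(u)\|:=\|[v]\|$ for any $v\in W(u)$, where $[v]=v+\overline{W(0)}\in V/\overline{W(0)}$ and $\|[v]\|=\inf\{\|v-e\|:e\in\overline{W(0)}\}$; $\|W\|:=\sup\{\|W(u)\|:u\in D(W),\ \|u\|\le1\}$; $W$ is bounded if $\|W\|<\infty$. *)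

theory Defs
  imports "HOL-Analysis.Analysis"
begin

text \<open>
  HOL-Analysis has no type class of complex normed spaces. To treat the scalar fields
  \<open>\<real>\<close> and \<open>\<complex>\<close> at once, the scalar multiplication is an explicit parameter over a type \<open>'k\<close> of
  class \<^class>\<open>real_normed_field\<close>; the norm and topology come from the type of vectors. The
  class contains \<^typ>\<open>real\<close> and \<^typ>\<open>complex\<close> and, by the Gelfand--Mazur theorem, nothing else up to
  isometric isomorphism.
\<close>

locale normed_space_over = vector_space scale
  for scale :: "'k::real_normed_field \<Rightarrow> 'a::real_normed_vector \<Rightarrow> 'a" +
  assumes norm_scale: "norm (scale c x) = norm c * norm x"
    and scale_of_real: "scale (of_real r) x = r *\<^sub>R x"

lemma normed_space_over_scaleR:
  "normed_space_over (scaleR :: real \<Rightarrow> 'a::real_normed_vector \<Rightarrow> 'a)"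
  by standard (auto simp: scaleR_add_right scaleR_add_left)

lemma normed_space_over_mult:
  "normed_space_over ((*) :: 'k::real_normed_field \<Rightarrow> 'k \<Rightarrow> 'k)"
  by standard (auto simp: algebra_simps norm_mult scaleR_conv_of_real)


definition LR :: "('k::real_normed_field \<Rightarrow> 'a::real_normed_vector \<Rightarrow> 'a)
    \<Rightarrow> ('k \<Rightarrow> 'b::real_normed_vector \<Rightarrow> 'b) \<Rightarrow> ('a \<times> 'b) set set"
  where "LR sX sY = {T. module.subspace (module_prod.scale sX sY) T}"

text \<open>
  For \<open>T \<in> LR sX sY\<close>, the domain, the range, \<open>T(x)\<close> and the inverse are \<^term>\<open>Domain T\<close>,
  \<^term>\<open>Range T\<close>, \<^term>\<open>T `` {x}\<close> and \<^term>\<open>T\<inverse>\<close>.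
\<close>

definition lr_kernel :: "('a \<times> 'b::zero) set \<Rightarrow> 'a set"
  where "lr_kernel T = {x. (x, 0) \<in> T}"

text \<open>The norm of the coset \<open>v + E\<close> in the quotient by the closed subspace \<open>E\<close>.\<close>

definition coset_norm :: "'b::real_normed_vector set \<Rightarrow> 'b \<Rightarrow> real"
  where "coset_norm E v = (INF e\<in>E. norm (v - e))"

text \<open>
  \<open>\<parallel>W(u)\<parallel>\<close>; the choice of \<open>v \<in> W(u)\<close> is immaterial, see \<open>lr_norm_at_eq\<close> below. The norm
  \<open>\<parallel>W\<parallel>\<close> takes the value \<open>\<infinity>\<close> when \<open>W\<close> is unbounded.
\<close>

definition lr_norm_at :: "('a::zero \<times> 'b::real_normed_vector) set \<Rightarrow> 'a \<Rightarrow> real"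
  where "lr_norm_at W u = coset_norm (closure (W `` {0})) (SOME v. (u, v) \<in> W)"

definition lr_norm :: "('a::real_normed_vector \<times> 'b::real_normed_vector) set \<Rightarrow> ereal"
  where "lr_norm W = (SUP u\<in>{u \<in> Domain W. norm u \<le> 1}. ereal (lr_norm_at W u))"

definition lr_bounded :: "('a::real_normed_vector \<times> 'b::real_normed_vector) set \<Rightarrow> bool"
  where "lr_bounded W \<longleftrightarrow> lr_norm W < \<infinity>"


lemma mem_LR_iff:
  assumes "normed_space_over sX" "normed_space_over sY"
  shows "T \<in> LR sX sY \<longleftrightarrow> (0, 0) \<in> T
    \<and> (\<forall>x y x' y'. (x, y) \<in> T \<longrightarrow> (x', y') \<in> T \<longrightarrow> (x + x', y + y') \<in> T)
    \<and> (\<forall>c x y. (x, y) \<in> T \<longrightarrow> (sX c x, sY c y) \<in> T)"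
proof -
  interpret X: normed_space_over sX by fact
  interpret Y: normed_space_over sY by fact
  interpret vector_space_prod sX sY ..
  show ?thesis
    by (simp add: LR_def p.subspace_def scale_def zero_prod_def Ball_def)
qed

lemma converse_in_LR:
  assumes "normed_space_over sX" "normed_space_over sY" "T \<in> LR sX sY"
  shows "T\<inverse> \<in> LR sY sX"
  using assms by (auto simp: mem_LR_iff)

lemma lr_norm_at_eq:
  assumes X: "normed_space_over sX" and Y: "normed_space_over sY"
    and W: "W \<in> LR sX sY" and v: "(u, v) \<in> W"
  shows "lr_norm_at W u = coset_norm (closure (W `` {0})) v"
proof -
  interpret X: normed_space_over sX by fact
  interpret Y: normed_space_over sY by fact
  note W' = W[unfolded mem_LR_iff[OF X Y]]
  define v' where "v' = (SOME v. (u, v) \<in> W)"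
  define E where "E = W `` {0}"
  have v': "(u, v') \<in> W" unfolding v'_def using v by (rule someI)
  have neg: "(- x, - y) \<in> W" if "(x, y) \<in> W" for x y
  proof -
    have "(sX (- 1) x, sY (- 1) y) \<in> W" using W' that by blast
    then show ?thesis by simp
  qed
  have add: "(x + x', y + y') \<in> W" if "(x, y) \<in> W" "(x', y') \<in> W" for x x' y y'
    using W' that by blast
  have w: "(0, v - v') \<in> W" "(0, v' - v) \<in> W"
    using add[OF v neg[OF v']] add[OF v' neg[OF v]] by simp_all
  have trans: "(\<lambda>e. d + e) ` E \<subseteq> E" if "(0, d) \<in> W" for d
    using add[OF that] by (auto simp: E_def)
  have tcl: "d + e \<in> closure E" if "(0, d) \<in> W" "e \<in> closure E" for d e
  proof -
    have "d + e \<in> (\<lambda>e. d + e) ` closure E" using that(2) by blast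
    also have "\<dots> = closure ((\<lambda>e. d + e) ` E)" by (simp add: closure_translation)
    also have "\<dots> \<subseteq> closure E" by (intro closure_mono trans that(1))
    finally show ?thesis .
  qed
  have "(\<lambda>e. norm (v' - e)) ` closure E = (\<lambda>e. norm (v - e)) ` closure E"
  proof (intro equalityI subsetI)
    fix r assume "r \<in> (\<lambda>e. norm (v' - e)) ` closure E"
    then obtain e where "e \<in> closure E" "r = norm (v' - e)" by blast
    then show "r \<in> (\<lambda>e. norm (v - e)) ` closure E"
      using tcl[OF w(1)] by (intro image_eqI[of _ _ "(v - v') + e"]) auto
  next
    fix r assume "r \<in> (\<lambda>e. norm (v - e)) ` closure E"
    then obtain e where "e \<in> closure E" "r = norm (v - e)" by blast
    then show "r \<in> (\<lambda>e. norm (v' - e)) ` closure E"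
      using tcl[OF w(2)] by (intro image_eqI[of _ _ "(v' - v) + e"]) auto
  qed
  then show ?thesis by (simp add: lr_norm_at_def coset_norm_def v'_def E_def)
qed

end

theory Submission
  imports Defs
begin

text \<open>
  The condition that \<open>T\<inverse>\<close> is bounded says that every \<open>(x, y) \<in> T\<close> satisfies
  \<open>dist(x, N(T)) \<le> K \<parallel>y\<parallel>\<close> with one constant \<open>K\<close> (lemma \<open>lr_bounded_iff\<close>, applied to \<open>T\<inverse>\<close>, whose value at
  \<open>0\<close> is \<open>N(T)\<close>).

  If \<open>T\<close> is closed, this is the open mapping theorem for the projection of \<open>T\<close> onto the
  Banach space \<open>R(T)\<close>. The usual argument works for relations without change: by Baire's theorem
  some set \<open>{y. \<exists>x. (x, y) \<in> T \<and> \<parallel>x\<parallel> \<le> n}\<close> is somewhere dense in \<open>R(T)\<close>, so each \<open>y \<in> R(T)\<close> has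
  approximate preimages of size \<open>C \<parallel>y\<parallel>\<close> (\<open>approximate_preimages\<close>), and summing up successive
  corrections of the error gives an exact preimage because \<open>T\<close> is closed
  (\<open>open_mapping_closed_relation\<close>). The kernel is closed because it is a section of \<open>T\<close>.

  Conversely, let \<open>(x\<^sub>n, y\<^sub>n) \<in> T\<close> tend to \<open>(x, y)\<close>. As \<open>R(T)\<close> is closed, \<open>y\<close> has a preimage \<open>x'\<close>,
  and boundedness gives \<open>dist(x\<^sub>n - x', N(T)) \<le> K \<parallel>y\<^sub>n - y\<parallel> \<longlonglongrightarrow> 0\<close>. Hence \<open>x - x'\<close> lies in the closed
  set \<open>N(T)\<close>, that is, \<open>(x, y) \<in> T\<close>.

  A subspace over \<open>'k\<close> is also a real subspace, and the open mapping argument is carried out for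
  real subspaces.
\<close>

section \<open>Linear relations as real subspaces\<close>

lemma LR_imp_subspace:
  assumes "normed_space_over sX" "normed_space_over sY" "T \<in> LR sX sY"
  shows "subspace T"
proof -
  interpret X: normed_space_over sX by fact
  interpret Y: normed_space_over sY by fact
  note T = assms(3)[unfolded mem_LR_iff[OF assms(1,2)]]
  have "(c *\<^sub>R x, c *\<^sub>R y) \<in> T" if "(x, y) \<in> T" for c x y
  proof -
    have "(sX (of_real c) x, sY (of_real c) y) \<in> T" using T that by blast
    then show ?thesis by (simp add: X.scale_of_real Y.scale_of_real)
  qed
  then show ?thesis
    using T by (auto simp: subspace_def zero_prod_def)
qed

lemma subspace_pairD:
  assumes "subspace T"
  shows "(x, y) \<in> T \<Longrightarrow> (x', y') \<in> T \<Longrightarrow> (x + x', y + y') \<in> T"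
    and "(x, y) \<in> T \<Longrightarrow> (x', y') \<in> T \<Longrightarrow> (x - x', y - y') \<in> T"
    and "(x, y) \<in> T \<Longrightarrow> (c *\<^sub>R x, c *\<^sub>R y) \<in> T"
    and "(0, 0) \<in> T"
  using subspace_add[OF assms, of "(x, y)" "(x', y')"] subspace_diff[OF assms, of "(x, y)" "(x', y')"]
    subspace_mul[OF assms, of "(x, y)" c] subspace_0[OF assms]
  by (auto simp: zero_prod_def)

lemma subspace_Range:
  assumes "subspace T"
  shows "subspace (Range T)"
proof -
  have "Range T = snd ` T" by (force simp: Range_iff image_iff)
  then show ?thesis
    using linear_subspace_image[OF linear_snd assms] by simp
qed

section \<open>Boundedness by a constant\<close>

lemma coset_norm_eq_infdist: "E \<noteq> {} \<Longrightarrow> coset_norm E v = infdist v E"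
  by (simp add: coset_norm_def infdist_notempty dist_norm)

lemma infdist_scaleR_le:
  fixes E :: "'a::real_normed_vector set"
  assumes "subspace E" "c > 0"
  shows "infdist (c *\<^sub>R v) E \<le> c * infdist v E"
proof -
  have E: "E \<noteq> {}" using subspace_0[OF assms(1)] by blast
  have "infdist (c *\<^sub>R v) E / c \<le> infdist v E"
    unfolding infdist_notempty[OF E, of v]
  proof (rule cINF_greatest[OF E])
    fix e assume "e \<in> E"
    then have "infdist (c *\<^sub>R v) E \<le> dist (c *\<^sub>R v) (c *\<^sub>R e)"
      by (intro infdist_le subspace_mul assms(1))
    also have "\<dots> = c * dist v e"
      using norm_scaleR[of c "v - e"] assms(2) by (simp add: dist_norm scaleR_diff_right)
    finally show "infdist (c *\<^sub>R v) E / c \<le> dist v e"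
      using assms(2) by (simp add: field_simps)
  qed
  then show ?thesis
    using assms(2) by (simp add: field_simps)
qed

text \<open>
  The closure in the definition of \<open>\<parallel>W(u)\<parallel>\<close> disappears because the distance to a set equals the
  distance to its closure.
\<close>

lemma infdist_closure: "infdist v (closure E) = infdist v E"
  by (simp add: infdist_eq_setdist)

text \<open>
  The supremum over the unit ball controls all of \<open>W\<close> by homogeneity, except at \<open>u = 0\<close>, where every
  \<open>v \<in> W(0)\<close> has distance \<open>0\<close> to \<open>W(0)\<close>.
\<close>

lemma lr_bounded_iff:
  assumes X: "normed_space_over sX" and Y: "normed_space_over sY" and W: "W \<in> LR sX sY"
  shows "lr_bounded W \<longleftrightarrow> (\<exists>K. \<forall>(u, v)\<in>W. infdist v (W `` {0}) \<le> K * norm u)"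
proof
  let ?E = "W `` {0}"
  note sub = LR_imp_subspace[OF assms]
  note W' = subspace_pairD[OF sub]
  have E: "subspace ?E"
    using W'(1)[of 0 _ 0] W'(3)[of 0] W'(4) by (auto simp: subspace_def)
  have ne: "closure ?E \<noteq> {}" using W'(4) by auto
  have at: "lr_norm_at W u = infdist v ?E" if "(u, v) \<in> W" for u v
    using lr_norm_at_eq[OF assms that] coset_norm_eq_infdist[OF ne] infdist_closure by metis
  {
    assume "lr_bounded W"
    then have "lr_norm W \<noteq> \<infinity>" by (auto simp: lr_bounded_def)
    then obtain K where "lr_norm W < ereal K" using less_PInf_Ex_of_nat by blast
    then have K: "lr_norm W \<le> ereal K" by (rule less_imp_le)
    have unit: "infdist v ?E \<le> K" if "(u, v) \<in> W" "norm u \<le> 1" for u v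
    proof -
      have "ereal (lr_norm_at W u) \<le> lr_norm W"
        unfolding lr_norm_def using that by (intro SUP_upper) auto
      then show ?thesis using K at[OF that(1)] order_trans by fastforce
    qed
    have "infdist v ?E \<le> K * norm u" if uv: "(u, v) \<in> W" for u v
    proof (cases "u = 0")
      case True
      then show ?thesis using uv by simp
    next
      case False
      then have pos: "norm u > 0" by simp
      have "infdist v ?E = infdist (norm u *\<^sub>R (inverse (norm u) *\<^sub>R v)) ?E"
        using pos by simp
      also have "\<dots> \<le> norm u * infdist (inverse (norm u) *\<^sub>R v) ?E"
        using E pos by (rule infdist_scaleR_le)
      also have "\<dots> \<le> norm u * K"
        using pos W'(3)[OF uv, of "inverse (norm u)"] by (intro mult_left_mono unit) auto
      finally show ?thesis by (simp add: mult.commute)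
    qed
    then show "\<exists>K. \<forall>(u, v)\<in>W. infdist v ?E \<le> K * norm u" by blast
  next
    assume "\<exists>K. \<forall>(u, v)\<in>W. infdist v ?E \<le> K * norm u"
    then obtain K where K: "\<And>u v. (u, v) \<in> W \<Longrightarrow> infdist v ?E \<le> K * norm u" by blast
    \<comment> \<open>nothing forces \<open>K \<ge> 0\<close> when the domain is \<open>{0}\<close>\<close>
    have "lr_norm W \<le> ereal \<bar>K\<bar>"
      unfolding lr_norm_def
    proof (rule SUP_least)
      fix u assume "u \<in> {u \<in> Domain W. norm u \<le> 1}"
      then obtain v where uv: "(u, v) \<in> W" "norm u \<le> 1" by blast
      have "infdist v ?E \<le> K * norm u" using K uv(1) .
      also have "\<dots> \<le> \<bar>K\<bar> * 1" using uv(2) by (intro mult_mono) auto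
      finally show "ereal (lr_norm_at W u) \<le> ereal \<bar>K\<bar>" using at[OF uv(1)] by simp
    qed
    then show "lr_bounded W" unfolding lr_bounded_def by auto
  }
qed

section \<open>The open mapping theorem for closed relations\<close>

text \<open>
  The sets of points having a preimage of norm at most \<open>n\<close> cover the range, so by Baire's theorem the
  closure of one of them contains a relative ball of some radius \<open>r\<close> around some point \<open>y0\<close>. Writing
  a small \<open>y\<close> as \<open>(y0 + y) - y0\<close> and approximating both terms moves the centre to \<open>0\<close> at the price of
  doubling \<open>n\<close>; homogeneity then handles all \<open>y\<close>.
\<close>

lemma approximate_preimages:
  fixes T :: "('a::real_normed_vector \<times> 'b::banach) set"
  assumes sub: "subspace T" and cl: "closed (Range T)"
  obtains C where "C \<ge> 0"
    "\<And>y e. y \<in> Range T \<Longrightarrow> e > 0 \<Longrightarrow> \<exists>x y'. (x, y') \<in> T \<and> norm x \<le> C * norm y \<and> norm (y - y') < e"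
proof -
  note T = subspace_pairD[OF sub]
  note R = subspace_Range[OF sub]
  define A where "A n = {y. \<exists>x. (x, y) \<in> T \<and> norm x \<le> real n}" for n
  have AR: "A n \<subseteq> Range T" for n by (auto simp: A_def)
  have clA: "closure (A n) \<subseteq> Range T" for n
    using AR cl by (rule closure_minimal)
  have cover: "(\<Union>n. closure (A n)) = Range T"
  proof
    show "Range T \<subseteq> (\<Union>n. closure (A n))"
    proof
      fix y assume "y \<in> Range T"
      then obtain x where "(x, y) \<in> T" by blast
      moreover obtain n where "norm x \<le> real n" using real_arch_simple by blast
      ultimately have "y \<in> A n" by (auto simp: A_def)
      then show "y \<in> (\<Union>n. closure (A n))" using closure_subset by blast
    qed
  qed (use clA in blast)
  have "\<exists>n. top_of_set (Range T) interior_of closure (A n) \<noteq> {}"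
  proof (rule ccontr)
    assume empty: "\<nexists>n. top_of_set (Range T) interior_of closure (A n) \<noteq> {}"
    have "completely_metrizable_space (top_of_set (Range T))"
      using cl closed_closedin completely_metrizable_space_closedin
        completely_metrizable_space_euclidean by blast
    then have "top_of_set (Range T) interior_of \<Union>(range (\<lambda>n. closure (A n))) = {}"
    proof (rule Baire_category_alt[OF disjI1])
      fix S assume "S \<in> range (\<lambda>n. closure (A n))"
      then obtain n where S: "S = closure (A n)" by blast
      show "closedin (top_of_set (Range T)) S \<and> top_of_set (Range T) interior_of S = {}"
        unfolding S using empty closed_subset[OF clA closed_closure] by blast
    qed simp
    then have "Range T = {}"
      using interior_of_topspace[of "top_of_set (Range T)"] by (simp add: cover)
    then show False using T(4) by blast
  qed
  then obtain n y0 where "y0 \<in> top_of_set (Range T) interior_of closure (A n)" by blast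
  then obtain U where U: "openin (top_of_set (Range T)) U" "y0 \<in> U" "U \<subseteq> closure (A n)"
    by (auto simp: interior_of_def)
  then obtain r where r: "r > 0" "ball y0 r \<inter> Range T \<subseteq> U"
    unfolding openin_contains_ball by blast
  have y0: "y0 \<in> Range T" "y0 \<in> closure (A n)" using U clA by auto
  have small: "\<exists>x y'. (x, y') \<in> T \<and> norm x \<le> 2 * real n \<and> norm (y - y') < e"
    if y: "y \<in> Range T" "norm y < r" and e: "e > 0" for y e
  proof -
    have "y0 + y \<in> ball y0 r" using y by (simp add: dist_norm)
    then have "y0 + y \<in> closure (A n)"
      using r(2) U(3) subspace_add[OF R y0(1) y(1)] by blast
    then obtain b where "b \<in> A n" and bd: "dist b (y0 + y) < e / 2"
      using e by (meson closure_approachable half_gt_zero)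
    moreover obtain a where "a \<in> A n" and ad: "dist a y0 < e / 2"
      using e y0(2) by (meson closure_approachable half_gt_zero)
    ultimately obtain x1 x2 where x: "(x1, b) \<in> T" "norm x1 \<le> n" "(x2, a) \<in> T" "norm x2 \<le> n"
      by (auto simp: A_def)
    have "norm (x1 - x2) \<le> 2 * real n"
      using x norm_triangle_ineq4[of x1 x2] by linarith
    moreover have "norm (y - (b - a)) < e"
    proof -
      have "y - (b - a) = (a - y0) - (b - (y0 + y))" by simp
      then have "norm (y - (b - a)) \<le> norm (a - y0) + norm (b - (y0 + y))"
        by (metis norm_triangle_ineq4)
      then show ?thesis using ad bd by (simp add: dist_norm)
    qed
    ultimately show ?thesis using T(2)[OF x(1,3)] by blast
  qed
  show thesis
  proof
    show "4 * real n / r \<ge> 0" using r(1) by simp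
    fix y e assume y: "y \<in> Range T" and e: "(e::real) > 0"
    show "\<exists>x y'. (x, y') \<in> T \<and> norm x \<le> 4 * real n / r * norm y \<and> norm (y - y') < e"
    proof (cases "y = 0")
      case True
      then show ?thesis using T(4) e by (intro exI[of _ 0]) auto
    next
      case False
      \<comment> \<open>the rescaled vector \<open>t *\<^sub>R y\<close> has norm \<open>r / 2\<close>\<close>
      define t where "t = r / (2 * norm y)"
      have t: "t > 0" using False r(1) by (simp add: t_def)
      have "norm (t *\<^sub>R y) < r" using False r(1) by (simp add: t_def)
      then obtain x y' where xy: "(x, y') \<in> T" "norm x \<le> 2 * real n" "norm (t *\<^sub>R y - y') < t * e"
        using small[OF subspace_mul[OF R y]] t e by (metis mult_pos_pos)
      have "norm (inverse t *\<^sub>R x) \<le> inverse t * (2 * real n)"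
        using t xy(2) by (simp add: mult_left_mono)
      also have "\<dots> = 4 * real n / r * norm y"
        using False r(1) by (simp add: t_def field_simps)
      finally have "norm (inverse t *\<^sub>R x) \<le> 4 * real n / r * norm y" .
      moreover have "norm (y - inverse t *\<^sub>R y') < e"
      proof -
        have "y - inverse t *\<^sub>R y' = inverse t *\<^sub>R (t *\<^sub>R y - y')"
          using t by (simp add: scaleR_diff_right)
        then have "norm (y - inverse t *\<^sub>R y') = inverse t * norm (t *\<^sub>R y - y')"
          using t by simp
        also have "\<dots> < inverse t * (t * e)"
          using t xy(3) by (intro mult_strict_left_mono) auto
        also have "\<dots> = e" using t by (simp add: field_simps)
        finally show ?thesis .
      qed
      ultimately show ?thesis using T(3)[OF xy(1)] by blast
    qed
  qed
qed

text \<open>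
  Correcting \<open>y\<close> by an approximate preimage at least halves the error. The corrections form
  a geometrically convergent series, whose partial sums are preimages of \<open>y\<close> minus the remaining
  error; closedness of \<open>T\<close> lets one pass to the limit.
\<close>

lemma open_mapping_closed_relation:
  fixes T :: "('a::banach \<times> 'b::banach) set"
  assumes sub: "subspace T" and cl: "closed (Range T)" and clT: "closed T"
  obtains K where "\<And>y. y \<in> Range T \<Longrightarrow> \<exists>x. (x, y) \<in> T \<and> norm x \<le> K * norm y"
proof -
  note T = subspace_pairD[OF sub]
  note R = subspace_Range[OF sub]
  obtain C where C: "C \<ge> 0"
    "\<And>y e. y \<in> Range T \<Longrightarrow> e > 0 \<Longrightarrow> \<exists>x y'. (x, y') \<in> T \<and> norm x \<le> C * norm y \<and> norm (y - y') < e"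
    using approximate_preimages[OF sub cl] by blast
  have "\<exists>x y'. (x, y') \<in> T \<and> norm x \<le> C * norm y \<and> norm (y - y') \<le> norm y / 2"
    if "y \<in> Range T" for y
  proof (cases "y = 0")
    case True
    then show ?thesis using T(4) by (intro exI[of _ 0]) auto
  next
    case False
    then show ?thesis using C(2)[OF that, of "norm y / 2"] by (meson half_gt_zero less_imp_le zero_less_norm_iff)
  qed
  then obtain f g where fg: "\<And>y. y \<in> Range T \<Longrightarrow>
      (f y, g y) \<in> T \<and> norm (f y) \<le> C * norm y \<and> norm (y - g y) \<le> norm y / 2"
    by metis
  have "\<exists>x. (x, y) \<in> T \<and> norm x \<le> (C * 2) * norm y" if y: "y \<in> Range T" for y
  proof -
    define z where "z n = ((\<lambda>y. y - g y) ^^ n) y" for n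
    have z0: "z 0 = y" and zS: "z (Suc n) = z n - g (z n)" for n
      by (simp_all add: z_def)
    have zR: "z n \<in> Range T" for n
    proof (induction n)
      case (Suc n)
      then have "g (z n) \<in> Range T" using fg by blast
      with Suc show ?case by (simp add: zS subspace_diff[OF R])
    qed (simp add: z0 y)
    have zn: "norm (z n) \<le> norm y * (1/2) ^ n" for n
    proof (induction n)
      case (Suc n)
      then show ?case using fg[OF zR[of n]] by (simp add: zS)
    qed (simp add: z0)
    have partial_sum: "(\<Sum>i<n. f (z i), y - z n) \<in> T" for n
    proof (induction n)
      case (Suc n)
      then show ?case
        using T(1)[OF Suc, of "f (z n)" "g (z n)"] fg[OF zR[of n]] by (simp add: zS algebra_simps)
    qed (simp add: z0 T(4))
    have fn: "norm (f (z n)) \<le> C * norm y * (1/2) ^ n" for n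
      using fg[OF zR[of n]] mult_left_mono[OF zn[of n] C(1)] by (simp add: mult.assoc)
    have sums: "(\<lambda>n. C * norm y * (1/2) ^ n) sums (C * norm y * 2)"
      using sums_mult[OF geometric_sums[of "1/2 :: real"], of "C * norm y"] by simp
    have f_summable: "summable (\<lambda>n. f (z n))"
      using sums_summable[OF sums] fn by (rule summable_comparison_test')
    have "(\<lambda>n. norm y * (1/2) ^ n) \<longlonglongrightarrow> norm y * 0"
      by (intro tendsto_intros) auto
    then have "z \<longlonglongrightarrow> 0"
      using zn by (intro Lim_null_comparison[of z]) auto
    then have "(\<lambda>n. (\<Sum>i<n. f (z i), y - z n)) \<longlonglongrightarrow> (\<Sum>n. f (z n), y - 0)"
      using f_summable by (intro tendsto_intros summable_LIMSEQ)
    then have "(\<Sum>n. f (z n), y) \<in> T"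
      using closed_sequentially[OF clT] partial_sum by fastforce
    moreover have "norm (\<Sum>n. f (z n)) \<le> (C * 2) * norm y"
      using norm_suminf_le[OF fn sums_summable[OF sums]] sums_unique[OF sums] by (simp add: mult_ac)
    ultimately show ?thesis by blast
  qed
  then show thesis using that by blast
qed

section \<open>Closed relations with closed range\<close>

theorem theorem5p2:
  fixes sX :: "'k::real_normed_field \<Rightarrow> 'a::banach \<Rightarrow> 'a"
    and sY :: "'k \<Rightarrow> 'b::banach \<Rightarrow> 'b"
    and T :: "('a \<times> 'b) set"
  assumes "normed_space_over sX" and "normed_space_over sY"
    and "T \<in> LR sX sY"
    and "closed (Range T)"
  shows "closed T \<longleftrightarrow> lr_bounded (T\<inverse>) \<and> closed (lr_kernel T)"
proof -
  note sub = LR_imp_subspace[OF assms(1-3)]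
  note T = subspace_pairD[OF sub]
  have "T\<inverse> `` {0} = lr_kernel T" by (auto simp: lr_kernel_def)
  then have bounded_iff: "lr_bounded (T\<inverse>) \<longleftrightarrow> (\<exists>K. \<forall>(x, y)\<in>T. infdist x (lr_kernel T) \<le> K * norm y)"
    using lr_bounded_iff[OF assms(2,1) converse_in_LR[OF assms(1-3)]] by fastforce
  show ?thesis
  proof
    assume clT: "closed T"
    obtain K where K: "\<And>y. y \<in> Range T \<Longrightarrow> \<exists>x. (x, y) \<in> T \<and> norm x \<le> K * norm y"
      using open_mapping_closed_relation[OF sub assms(4) clT] by blast
    have "infdist x (lr_kernel T) \<le> K * norm y" if xy: "(x, y) \<in> T" for x y
    proof -
      obtain x' where x': "(x', y) \<in> T" "norm x' \<le> K * norm y" using K xy by blast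
      have "x - x' \<in> lr_kernel T" using T(2)[OF xy x'(1)] by (simp add: lr_kernel_def)
      then have "infdist x (lr_kernel T) \<le> dist x (x - x')" by (rule infdist_le)
      then show ?thesis using x'(2) by (simp add: dist_norm)
    qed
    moreover have "closed (lr_kernel T)"
    proof -
      have "lr_kernel T = (\<lambda>x. (x, 0)) -` T" by (auto simp: lr_kernel_def)
      then show ?thesis using clT by (simp add: closed_vimage continuous_on_Pair)
    qed
    ultimately show "lr_bounded (T\<inverse>) \<and> closed (lr_kernel T)"
      using bounded_iff by blast
  next
    assume "lr_bounded (T\<inverse>) \<and> closed (lr_kernel T)"
    then obtain K where K: "\<And>x y. (x, y) \<in> T \<Longrightarrow> infdist x (lr_kernel T) \<le> K * norm y"
      and clN: "closed (lr_kernel T)" using bounded_iff by blast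
    have N: "lr_kernel T \<noteq> {}" using T(4) by (auto simp: lr_kernel_def)
    have "l \<in> T" if p: "\<And>n. p n \<in> T" and lim: "p \<longlonglongrightarrow> l" for p l
    proof -
      obtain x y where l: "l = (x, y)" by force
      have fst_lim: "(\<lambda>n. fst (p n)) \<longlonglongrightarrow> x" and snd_lim: "(\<lambda>n. snd (p n)) \<longlonglongrightarrow> y"
        using tendsto_fst[OF lim] tendsto_snd[OF lim] by (simp_all add: l)
      have "snd (p n) \<in> Range T" for n using p[of n] by (metis Range.intros prod.collapse)
      then have "y \<in> Range T" 
        using closed_sequentially[OF assms(4), of "\<lambda>n. snd (p n)" y] snd_lim by auto
      then obtain x' where x': "(x', y) \<in> T" by blast
      have "(fst (p n) - x', snd (p n) - y) \<in> T" for n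
        using T(2)[OF _ x'] p[of n] by simp
      then have bound: "infdist (fst (p n) - x') (lr_kernel T) \<le> K * norm (snd (p n) - y)" for n
        by (rule K)
      have "(\<lambda>n. infdist (fst (p n) - x') (lr_kernel T)) \<longlonglongrightarrow> infdist (x - x') (lr_kernel T)"
        using fst_lim by (intro tendsto_intros)
      moreover have "(\<lambda>n. K * norm (snd (p n) - y)) \<longlonglongrightarrow> K * norm (y - y)"
        using snd_lim by (intro tendsto_intros)
      ultimately have "infdist (x - x') (lr_kernel T) \<le> K * norm (y - y)"
        using bound by (intro LIMSEQ_le) auto
      then have "infdist (x - x') (lr_kernel T) = 0"
        using infdist_nonneg[of "x - x'" "lr_kernel T"] by simp
      then have "x - x' \<in> lr_kernel T"
        using in_closed_iff_infdist_zero[OF clN N] by simp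
      then have "(x - x', 0) \<in> T" by (simp add: lr_kernel_def)
      then show ?thesis using T(1)[OF _ x', of "x - x'" 0] by (simp add: l)
    qed
    then show "closed T" by (auto simp: closed_sequential_limits)
  qed
qed

end
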